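(* The problem of classifying $m\times n\times 3$ spatial matrices up to equivalence is wild, i.e., it contains the problem of classifying pairs of square matrices up to simultaneous similarity.
   Context: Matrices are over a field $k$. An $m\times n\times q$ spatial matrix is a family $[a_{ijk}]_{i=1}^m{}_{j=1}^n{}_{k=1}^q$ of elements of $k$ ($m,n$ arbitrary here, $q=3$). Two spatial matrices $[a_{ijk}],[a'_{ijk}]$ are equivalent if $a'_{i'j'k'}=\sum_{i,j,k}a_{ijk}r_{ii'}s_{jj'}t_{kk'}$ for nonsingular matrices $R=[r_{ii'}]$, $S=[s_{jj'}]$, $T=[t_{kk'}]$. The pair problem: pairs $(X,Y)$ of $r\times r$ matrices ($r$ arbitrary) up to simultaneous similarity $(X,Y)\mapsto(S^{-1}XS,S^{-1}YS)$. A matrix problem $\mathcal A$ is given by a set $\mathcal A_1$ of $a$-tuples of matrices and admissible transformations ("$A$ reduces to $A'$"). $\mathcal B$ contains $\mathcal A$ if there is a $b$-tuple $\mathcal T(x_1,\dots,x_a)$ of matrices whose entries are noncommutative polynomials in $x_1,\dots,x_a$ (substitution done blockwise, scalars $c$ becoming $cI$) such that (i) $\mathcal T(A)\in\mathcal B_1$ for $A\in\mathcal A_1$, and (ii) $A$ reduces to $A'$ iff $\mathcal T(A)$ reduces to $\mathcal T(A')$. A problem is wild if it contains the pair problem. *)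

theory Defs
  imports "Jordan_Normal_Form.Matrix"
begin

text \<open>Noncommutative polynomials with coefficients in k in two variables x1, x2,
  represented by expressions (the free associative algebra is the quotient of these
  expressions; only their evaluation matters).\<close>
datatype 'k ncpoly = NConst 'k | NVar1 | NVar2
  | NAdd "'k ncpoly" "'k ncpoly" | NMul "'k ncpoly" "'k ncpoly"

fun nc_eval :: "'k::field mat \<Rightarrow> 'k mat \<Rightarrow> 'k ncpoly \<Rightarrow> 'k mat" where
  "nc_eval X Y (NConst c) = c \<cdot>\<^sub>m 1\<^sub>m (dim_row X)"
| "nc_eval X Y NVar1 = X"
| "nc_eval X Y NVar2 = Y"
| "nc_eval X Y (NAdd p q) = nc_eval X Y p + nc_eval X Y q"
| "nc_eval X Y (NMul p q) = nc_eval X Y p * nc_eval X Y q"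

definition nc_subst :: "'k::field mat \<Rightarrow> 'k mat \<Rightarrow> 'k ncpoly mat \<Rightarrow> 'k mat" where
  "nc_subst X Y P = (let r = dim_row X in
     mat (dim_row P * r) (dim_col P * r)
       (\<lambda>(i, j). nc_eval X Y (P $$ (i div r, j div r)) $$ (i mod r, j mod r)))"

definition is_pair :: "'k::field mat \<times> 'k mat \<Rightarrow> bool" where
  "is_pair XY \<longleftrightarrow> (\<exists>r. fst XY \<in> carrier_mat r r \<and> snd XY \<in> carrier_mat r r)"

definition pair_sim :: "'k::field mat \<times> 'k mat \<Rightarrow> 'k mat \<times> 'k mat \<Rightarrow> bool" where
  "pair_sim XY XY' \<longleftrightarrow> (\<exists>r S Sinv.
     fst XY \<in> carrier_mat r r \<and> snd XY \<in> carrier_mat r r \<and>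
     S \<in> carrier_mat r r \<and> Sinv \<in> carrier_mat r r \<and>
     S * Sinv = 1\<^sub>m r \<and> Sinv * S = 1\<^sub>m r \<and>
     fst XY' = Sinv * fst XY * S \<and> snd XY' = Sinv * snd XY * S)"

text \<open>An m x n x 3 spatial matrix [a_ijk], represented as the list of its three
  slices A!k = [a_ijk]_ij (k = 0,1,2), each an m x n matrix.\<close>
definition spatial3 :: "'k::field mat list \<Rightarrow> bool" where
  "spatial3 A \<longleftrightarrow> length A = 3 \<and> (\<exists>m n. \<forall>k<3. A ! k \<in> carrier_mat m n)"

definition spatial_equiv :: "'k::field mat list \<Rightarrow> 'k mat list \<Rightarrow> bool" where
  "spatial_equiv A A' \<longleftrightarrow> (\<exists>m n R S T.
     length A = 3 \<and> length A' = 3 \<and>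
     (\<forall>k<3. A ! k \<in> carrier_mat m n \<and> A' ! k \<in> carrier_mat m n) \<and>
     R \<in> carrier_mat m m \<and> invertible_mat R \<and>
     S \<in> carrier_mat n n \<and> invertible_mat S \<and>
     T \<in> carrier_mat 3 3 \<and> invertible_mat T \<and>
     (\<forall>i'<m. \<forall>j'<n. \<forall>k'<3.
        A' ! k' $$ (i', j') =
          (\<Sum>i<m. \<Sum>j<n. \<Sum>k<3.
              A ! k $$ (i, j) * R $$ (i, i') * S $$ (j, j') * T $$ (k, k'))))"

definition spatial3_contains_pairs :: "'k::field itself \<Rightarrow> bool" where
  "spatial3_contains_pairs TYPE('k) \<longleftrightarrow>
    (\<exists>T :: 'k ncpoly mat list. length T = 3 \<and>
      (\<forall>XY :: 'k mat \<times> 'k mat. is_pair XY \<longrightarrow>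
         spatial3 (map (nc_subst (fst XY) (snd XY)) T)) \<and>
      (\<forall>XY XY' :: 'k mat \<times> 'k mat. is_pair XY \<longrightarrow> is_pair XY' \<longrightarrow>
         (pair_sim XY XY' \<longleftrightarrow>
          spatial_equiv (map (nc_subst (fst XY) (snd XY)) T)
                        (map (nc_subst (fst XY') (snd XY')) T))))"

end

theory Submission
  imports Defs "Jordan_Normal_Form.Determinant"
begin

text \<open>The slices of the encoding are three block matrices with a small core carrying X and Y, plus
  identity blocks of such different sizes that comparing ranks of linear combinations of the slices
  forces the matrix T that mixes them to be diagonal. After that, an equivalence is a
  relation P A'_k = t_k A_k S between corresponding slices. On the core it forces S to be
  block diagonal with equal blocks C satisfying C X' = X C and C Y' = Y C; since C is the only nonzero
  block in the first block row of S, it is invertible. The scalars t_k drop out because the entries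
  x + z and y + z of the core contain identity blocks from all three slices.
  Conversely, conjugating X and Y by C conjugates every block of every slice.\<close>

text \<open>The 20 x 21 block matrix of linear forms in x, y, z, whose coefficients are the three slices,
  is the direct sum of the 2 x 3 core with rows (x + z, y + z, 0) and (0, x + zX, y + zY) and of
  x I, y I, z I of block sizes 9, 6, 3. So row i of the diagonal part meets column i + 1.\<close>

definition slice :: "nat \<Rightarrow> 'k::field ncpoly mat" where
  "slice k = mat 20 21 (\<lambda>(i, j).
     if k = 0 then NConst (if i < 2 \<and> j = i \<or> 2 \<le> i \<and> i < 11 \<and> j = i + 1 then 1 else 0)
     else if k = 1 then NConst (if j = i + 1 \<and> (i < 2 \<or> 11 \<le> i \<and> i < 17) then 1 else 0)
     else if i = 1 \<and> j = 1 then NVar1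
     else if i = 1 \<and> j = 2 then NVar2
     else NConst (if i = 0 \<and> j \<le> 1 \<or> 17 \<le> i \<and> j = i + 1 then 1 else 0))"

lemma dim_slice: "dim_row (slice k) = 20" "dim_col (slice k) = 21"
  by (simp_all add: slice_def)

section \<open>Scalar entries of the encoded slices\<close>

text \<open>Here \<open>p\<close> and \<open>q\<close> are scalar coordinates: block row
  \<open>i\<close> consists of the rows \<open>i * r + a\<close> with \<open>a < r\<close>. The
  shift by one block column turns into \<open>q = p + r\<close>, and the core is
  \<open>p < 2 * r\<close>, \<open>q < 3 * r\<close>. In this form sums over rows and columns can be
  evaluated without \<open>div\<close> and \<open>mod\<close>.\<close>

definition slice_entry :: "nat \<Rightarrow> 'k::field mat \<Rightarrow> 'k mat \<Rightarrow> nat \<Rightarrow> nat \<Rightarrow> nat \<Rightarrow> 'k" where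
  "slice_entry r X Y k p q =
     (if k = 0 then (if p < 2 * r \<and> q = p \<or> 2 * r \<le> p \<and> p < 11 * r \<and> q = p + r then 1 else 0)
      else if k = 1 then (if q = p + r \<and> (p < 2 * r \<or> 11 * r \<le> p \<and> p < 17 * r) then 1 else 0)
      else if r \<le> p \<and> p < 2 * r \<and> r \<le> q \<and> q < 2 * r then X $$ (p - r, q - r)
      else if r \<le> p \<and> p < 2 * r \<and> 2 * r \<le> q \<and> q < 3 * r then Y $$ (p - r, q - 2 * r)
      else if p < r \<and> (q = p \<or> q = p + r) \<or> 17 * r \<le> p \<and> q = p + r then 1 else 0)"

lemma nc_eval_carrier:
  assumes "X \<in> carrier_mat r r" "Y \<in> carrier_mat r r"
  shows "nc_eval X Y p \<in> carrier_mat r r"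
  using assms by (induction p) auto

lemma nc_subst_carrier:
  assumes "X \<in> carrier_mat r r"
  shows "nc_subst X Y P \<in> carrier_mat (dim_row P * r) (dim_col P * r)"
  using assms by (auto simp: nc_subst_def Let_def)

lemma block_index_less_iff:
  fixes i :: nat
  assumes "a < r"
  shows "i * r + a < n * r \<longleftrightarrow> i < n"
  using div_less_iff_less_mult[of r "i * r + a" n] assms by simp

lemma block_index_eq_iff:
  fixes i :: nat
  assumes "a < r" "b < r"
  shows "i * r + a = j * r + b \<longleftrightarrow> i = j \<and> a = b"
  using block_index_less_iff[OF assms(1), of i "Suc j"] block_index_less_iff[OF assms(2), of j "Suc i"] assms
  by (cases "i = j") auto

lemma nc_subst_index:
  assumes "X \<in> carrier_mat r r" "i < dim_row P" "j < dim_col P" "a < r" "b < r"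
  shows "nc_subst X Y P $$ (i * r + a, j * r + b) = nc_eval X Y (P $$ (i, j)) $$ (a, b)"
proof -
  have "i * r + a < dim_row P * r" "j * r + b < dim_col P * r"
    using assms by (simp_all add: block_index_less_iff)
  then show ?thesis
    using assms by (auto simp: nc_subst_def Let_def)
qed

lemma block_index_less:
  fixes p :: nat
  assumes "p < n * r"
  obtains i a where "i < n" "a < r" "p = i * r + a"
proof
  have "r > 0" using assms by (cases r) auto
  then show "p mod r < r" by simp
  show "p div r < n" using assms by (simp add: less_mult_imp_div_less)
  show "p = p div r * r + p mod r" by simp
qed

lemma nc_subst_slice:
  assumes X: "X \<in> carrier_mat r r" and Y: "Y \<in> carrier_mat r r"
    and p: "p < 20 * r" and q: "q < 21 * r" and k: "k < 3"
  shows "nc_subst X Y (slice k) $$ (p, q) = slice_entry r X Y k p q"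
proof -
  obtain i a where i: "i < 20" "a < r" "p = i * r + a" using p by (rule block_index_less)
  obtain j b where j: "j < 21" "b < r" "q = j * r + b" using q by (rule block_index_less)
  \<comment> \<open>Each comparison of \<open>p\<close> or \<open>q\<close> with a multiple of
    \<open>r\<close> in \<open>slice_entry\<close> turns into a comparison of block indices, as
    tested in \<open>slice\<close>.\<close>
  have lt: "p < n * r \<longleftrightarrow> i < n" "q < n * r \<longleftrightarrow> j < n" for n
    using i j by (simp_all add: block_index_less_iff)
  have le: "n * r \<le> p \<longleftrightarrow> n \<le> i" "n * r \<le> q \<longleftrightarrow> n \<le> j" for n
    using lt[of n] by linarith+
  have lt1: "p < r \<longleftrightarrow> i < 1" "r \<le> p \<longleftrightarrow> 1 \<le> i" "q < r \<longleftrightarrow> j < 1" "r \<le> q \<longleftrightarrow> 1 \<le> j"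
    using lt[of 1] le[of 1] by simp_all
  have eq: "q = p \<longleftrightarrow> j = i \<and> b = a" "q = p + r \<longleftrightarrow> j = i + 1 \<and> b = a"
    using block_index_eq_iff[OF j(2) i(2), of j i] block_index_eq_iff[OF j(2) i(2), of j "i + 1"] i j
    by (auto simp: algebra_simps)
  have sub: "j = 1 \<Longrightarrow> q - r = b" "j = 2 \<Longrightarrow> q - 2 * r = b" "i = 1 \<Longrightarrow> p - r = a"
    using i j by auto
  have "nc_subst X Y (slice k) $$ (p, q) = nc_eval X Y (slice k $$ (i, j)) $$ (a, b)"
    unfolding i j using X i j by (intro nc_subst_index) (auto simp: dim_slice)
  also have "\<dots> = slice_entry r X Y k p q"
    unfolding slice_entry_def lt le lt1 eq
    using i(1,2) j(1,2) k X sub by (auto simp: slice_def less_Suc_eq numeral_eq_Suc)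
  finally show ?thesis .
qed

subsection \<open>Rank bounds\<close>

text \<open>Gaussian elimination, one coordinate of \<open>L\<close> at a time. Clearing the
  coordinate \<open>l\<close> with a pivot vector \<open>g i0\<close> uses up one vector and one
  coordinate, so there remain more vectors than coordinates.\<close>

lemma ex_null_combination:
  fixes g :: "'i \<Rightarrow> 'l \<Rightarrow> 'k::field"
  assumes "finite L" "finite I" "card L < card I"
  shows "\<exists>c. (\<exists>i\<in>I. c i \<noteq> 0) \<and> (\<forall>l\<in>L. (\<Sum>i\<in>I. c i * g i l) = 0)"
  using assms
proof (induction L arbitrary: I g rule: finite_induct)
  case empty
  then have "I \<noteq> {}" by auto
  then show ?case by (intro exI[of _ "\<lambda>_. 1"]) auto
next
  case (insert l L)
  show ?case
  proof (cases "\<forall>i\<in>I. g i l = 0")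
    case True
    then show ?thesis using insert.IH[of I g] insert.prems insert.hyps by auto
  next
    case False
    then obtain i0 where i0: "i0 \<in> I" "g i0 l \<noteq> 0" by auto
    define I' where "I' = I - {i0}"
    define g' where "g' i m = g i m - g i l / g i0 l * g i0 m" for i m
    have I': "finite I'" "card L < card I'" "i0 \<notin> I'" "I = insert i0 I'"
      using insert.prems insert.hyps i0 by (auto simp: I'_def)
    then obtain c where c: "\<exists>i\<in>I'. c i \<noteq> 0" "\<forall>m\<in>L. (\<Sum>i\<in>I'. c i * g' i m) = 0"
      using insert.IH[of I' g'] by auto
    \<comment> \<open>The vectors \<open>g' i\<close> differ from \<open>g i\<close> by multiples of
      \<open>g i0\<close>; \<open>d\<close> collects these multiples, so the coefficient
      \<open>- d\<close> at the pivot reproduces the combination of the \<open>g' i\<close>.\<close>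
    define d where "d = (\<Sum>i\<in>I'. c i * g i l) / g i0 l"
    define c' where "c' = c(i0 := - d)"
    have c'_I': "(\<Sum>i\<in>I'. c' i * f i) = (\<Sum>i\<in>I'. c i * f i)" for f
      using I' by (intro sum.cong) (auto simp: c'_def)
    have split: "(\<Sum>i\<in>I. c' i * g i m) = - d * g i0 m + (\<Sum>i\<in>I'. c i * g i m)" for m
      using I' c'_I'[of "\<lambda>i. g i m"] by (simp add: c'_def)
    have "(\<Sum>i\<in>I'. c i * g' i m) = (\<Sum>i\<in>I'. c i * g i m) - d * g i0 m" for m
      unfolding g'_def d_def
      by (simp add: right_diff_distrib sum_subtractf sum_divide_distrib sum_distrib_right mult.assoc)
    then have "(\<Sum>i\<in>I. c' i * g i m) = 0" if "m \<in> L" for m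
      using c(2) that split[of m] by simp
    moreover have "(\<Sum>i\<in>I. c' i * g i l) = 0"
      using split[of l] i0 by (simp add: d_def)
    moreover have "\<exists>i\<in>I. c' i \<noteq> 0"
      using c(1) I' by (auto simp: c'_def)
    ultimately show ?thesis by blast
  qed
qed

text \<open>An invertible diagonal matrix of size \<open>card I\<close> cannot factor through a
  space of smaller dimension: a nonzero left null vector of \<open>g\<close> would also annihilate
  the product of \<open>g\<close> and \<open>h\<close>, whose diagonal has no zero.\<close>

lemma card_le_of_diagonal_factorization:
  fixes g :: "'i \<Rightarrow> 'l \<Rightarrow> 'k::field" and h :: "'l \<Rightarrow> 'i \<Rightarrow> 'k"
  assumes fin: "finite L" "finite I"
    and gh: "\<And>i j. i \<in> I \<Longrightarrow> j \<in> I \<Longrightarrow> (\<Sum>l\<in>L. g i l * h l j) = (if i = j then d i else 0)"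
    and d: "\<And>i. i \<in> I \<Longrightarrow> d i \<noteq> 0"
  shows "card I \<le> card L"
proof (rule ccontr)
  assume "\<not> card I \<le> card L"
  then obtain c j where c: "j \<in> I" "c j \<noteq> 0" "\<forall>l\<in>L. (\<Sum>i\<in>I. c i * g i l) = 0"
    using ex_null_combination[OF fin, of g] by auto
  have "0 = (\<Sum>l\<in>L. (\<Sum>i\<in>I. c i * g i l) * h l j)"
    using c by simp
  also have "\<dots> = (\<Sum>l\<in>L. \<Sum>i\<in>I. c i * (g i l * h l j))"
    by (simp add: sum_distrib_right mult.assoc)
  also have "\<dots> = (\<Sum>i\<in>I. c i * (\<Sum>l\<in>L. g i l * h l j))"
    by (subst sum.swap) (simp add: sum_distrib_left)
  also have "\<dots> = (\<Sum>i\<in>I. if i = j then c i * d i else 0)"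
    using gh c by (intro sum.cong) auto
  also have "\<dots> = c j * d j"
    using c fin by simp
  finally show False using c d by simp
qed

subsection \<open>Intertwiners of the three slices\<close>

text \<open>Core rows of a slice applied to a column \<open>s\<close>. Slices 0 and 1 have a single
  1 in each such row; slice 2 has two identity blocks in block row 0, and \<open>X\<close>,
  \<open>Y\<close> in block row 1.\<close>

lemma slice_entry_row:
  fixes s :: "nat \<Rightarrow> 'k::field"
  shows "p < 2 * r \<Longrightarrow> (\<Sum>l<21 * r. slice_entry r X Y 0 p l * s l) = s p"
    and "p < 2 * r \<Longrightarrow> (\<Sum>l<21 * r. slice_entry r X Y 1 p l * s l) = s (r + p)"
    and "p < r \<Longrightarrow> (\<Sum>l<21 * r. slice_entry r X Y 2 p l * s l) = s p + s (r + p)"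
    and "p < r \<Longrightarrow> (\<Sum>l<21 * r. slice_entry r X Y 2 (r + p) l * s l) =
           (\<Sum>c<r. X $$ (p, c) * s (r + c)) + (\<Sum>c<r. Y $$ (p, c) * s (2 * r + c))"
proof -
  assume p: "p < 2 * r"
  have "(\<Sum>l<21 * r. slice_entry r X Y 0 p l * s l) = (\<Sum>l\<in>{p}. s l)"
    using p by (intro sum.mono_neutral_cong_right) (auto simp: slice_entry_def)
  then show "(\<Sum>l<21 * r. slice_entry r X Y 0 p l * s l) = s p" by simp
  have "(\<Sum>l<21 * r. slice_entry r X Y 1 p l * s l) = (\<Sum>l\<in>{r + p}. s l)"
    using p by (intro sum.mono_neutral_cong_right) (auto simp: slice_entry_def)
  then show "(\<Sum>l<21 * r. slice_entry r X Y 1 p l * s l) = s (r + p)" by simp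
next
  assume p: "p < r"
  have "(\<Sum>l<21 * r. slice_entry r X Y 2 p l * s l) = (\<Sum>l\<in>{p, r + p}. s l)"
    using p by (intro sum.mono_neutral_cong_right) (auto simp: slice_entry_def)
  then show "(\<Sum>l<21 * r. slice_entry r X Y 2 p l * s l) = s p + s (r + p)"
    using p by simp
  have "(\<Sum>l<21 * r. slice_entry r X Y 2 (r + p) l * s l) =
      (\<Sum>l\<in>{r..<2 * r} \<union> {2 * r..<3 * r}.
        (if l < 2 * r then X $$ (p, l - r) else Y $$ (p, l - 2 * r)) * s l)"
    using p by (intro sum.mono_neutral_cong_right) (auto simp: slice_entry_def)
  also have "\<dots> = (\<Sum>l\<in>{r..<2 * r}. X $$ (p, l - r) * s l) +
      (\<Sum>l\<in>{2 * r..<3 * r}. Y $$ (p, l - 2 * r) * s l)"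
    by (subst sum.union_disjoint) (auto intro!: sum.cong arg_cong2[of _ _ _ _ "(+)"])
  also have "(\<Sum>l\<in>{r..<2 * r}. X $$ (p, l - r) * s l) = (\<Sum>c<r. X $$ (p, c) * s (r + c))"
    using sum.shift_bounds_nat_ivl[of "\<lambda>l. X $$ (p, l - r) * s l" 0 r r]
    by (simp add: mult_2 lessThan_atLeast0 add.commute)
  also have "(\<Sum>l\<in>{2 * r..<3 * r}. Y $$ (p, l - 2 * r) * s l) = (\<Sum>c<r. Y $$ (p, c) * s (2 * r + c))"
    using sum.shift_bounds_nat_ivl[of "\<lambda>l. Y $$ (p, l - 2 * r) * s l" 0 "2 * r" r]
    by (simp add: lessThan_atLeast0 add.commute)
  finally show "(\<Sum>l<21 * r. slice_entry r X Y 2 (r + p) l * s l) =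
      (\<Sum>c<r. X $$ (p, c) * s (r + c)) + (\<Sum>c<r. Y $$ (p, c) * s (2 * r + c))" .
qed

text \<open>A row \<open>s\<close> applied to slice 0. Each column holds at most one 1, in row
  \<open>q\<close> in the core and in row \<open>q - r\<close> in the shifted diagonal part. Block
  column 2 and all from 12 on are zero, which later forces blocks of an intertwiner to
  vanish.\<close>

lemma slice_entry_col_0:
  fixes s :: "nat \<Rightarrow> 'k::field"
  assumes "q < 21 * r"
  shows "(\<Sum>l<20 * r. s l * slice_entry r X Y 0 l q) =
    (if q < 2 * r then s q else if 3 * r \<le> q \<and> q < 12 * r then s (q - r) else 0)"
proof -
  have "(\<Sum>l<20 * r. s l * slice_entry r X Y 0 l q) =
      (\<Sum>l\<in>(if q < 2 * r then {q} else if 3 * r \<le> q \<and> q < 12 * r then {q - r} else {}). s l)"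
    using assms by (intro sum.mono_neutral_cong_right) (auto simp: slice_entry_def split: if_splits)
  then show ?thesis by simp
qed

lemma slice_entry_col_1:
  fixes s :: "nat \<Rightarrow> 'k::field"
  assumes "q < 21 * r"
  shows "(\<Sum>l<20 * r. s l * slice_entry r X Y 1 l q) =
    (if r \<le> q \<and> q < 3 * r \<or> 12 * r \<le> q \<and> q < 18 * r then s (q - r) else 0)"
proof -
  have "(\<Sum>l<20 * r. s l * slice_entry r X Y 1 l q) =
      (\<Sum>l\<in>(if r \<le> q \<and> q < 3 * r \<or> 12 * r \<le> q \<and> q < 18 * r then {q - r} else {}). s l)"
    using assms by (intro sum.mono_neutral_cong_right) (auto simp: slice_entry_def split: if_splits)
  then show ?thesis by simp
qed

text \<open>The last equation holds because block columns 3 to 17 carry the identity blocks of the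
  other two slices.\<close>

lemma slice_entry_col_2:
  fixes s :: "nat \<Rightarrow> 'k::field"
  shows "q < r \<Longrightarrow> (\<Sum>l<20 * r. s l * slice_entry r X Y 2 l q) = s q"
    and "q < r \<Longrightarrow> (\<Sum>l<20 * r. s l * slice_entry r X Y 2 l (r + q)) =
           s q + (\<Sum>c<r. s (r + c) * X $$ (c, q))"
    and "q < r \<Longrightarrow> (\<Sum>l<20 * r. s l * slice_entry r X Y 2 l (2 * r + q)) =
           (\<Sum>c<r. s (r + c) * Y $$ (c, q))"
    and "3 * r \<le> q \<Longrightarrow> q < 18 * r \<Longrightarrow> (\<Sum>l<20 * r. s l * slice_entry r X Y 2 l q) = 0"
proof -
  assume q: "q < r"
  have "(\<Sum>l<20 * r. s l * slice_entry r X Y 2 l q) = (\<Sum>l\<in>{q}. s l)"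
    using q by (intro sum.mono_neutral_cong_right) (auto simp: slice_entry_def)
  then show "(\<Sum>l<20 * r. s l * slice_entry r X Y 2 l q) = s q" by simp
  have shift: "(\<Sum>l\<in>{r..<2 * r}. s l * Z $$ (l - r, q)) = (\<Sum>c<r. s (r + c) * Z $$ (c, q))" for Z
    using sum.shift_bounds_nat_ivl[of "\<lambda>l. s l * Z $$ (l - r, q)" 0 r r]
    by (simp add: mult_2 lessThan_atLeast0 add.commute)
  have "(\<Sum>l<20 * r. s l * slice_entry r X Y 2 l (r + q)) =
      (\<Sum>l\<in>insert q {r..<2 * r}. s l * (if l = q then 1 else X $$ (l - r, q)))"
    using q by (intro sum.mono_neutral_cong_right) (auto simp: slice_entry_def)
  also have "\<dots> = s q + (\<Sum>l\<in>{r..<2 * r}. s l * X $$ (l - r, q))"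
    using q by (subst sum.insert) (auto intro!: sum.cong)
  finally show "(\<Sum>l<20 * r. s l * slice_entry r X Y 2 l (r + q)) =
      s q + (\<Sum>c<r. s (r + c) * X $$ (c, q))"
    by (simp add: shift)
  have "(\<Sum>l<20 * r. s l * slice_entry r X Y 2 l (2 * r + q)) =
      (\<Sum>l\<in>{r..<2 * r}. s l * Y $$ (l - r, q))"
    using q by (intro sum.mono_neutral_cong_right) (auto simp: slice_entry_def)
  then show "(\<Sum>l<20 * r. s l * slice_entry r X Y 2 l (2 * r + q)) =
      (\<Sum>c<r. s (r + c) * Y $$ (c, q))"
    by (simp add: shift)
next
  assume "3 * r \<le> q" "q < 18 * r"
  then show "(\<Sum>l<20 * r. s l * slice_entry r X Y 2 l q) = 0"
    by (intro sum.neutral) (auto simp: slice_entry_def)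
qed

text \<open>Let S_ij and P_ij be the r x r blocks, counted from 0. In the two core block rows,
  slices 0 and 1 give P_ij = t_0 S_ij = t_1 S_(i+1)(j+1) for i, j < 2, along with several zero
  blocks. Slice 2 then gives S_00 = S_11, from which S_22 = S_00 follows, and its block row 1
  becomes the relations with \<open>X\<close> and \<open>Y\<close>.\<close>

lemma intertwining_first_row:
  fixes P S :: "nat \<Rightarrow> nat \<Rightarrow> 'k::field"
  assumes eq: "\<And>k p q. k < 3 \<Longrightarrow> p < 20 * r \<Longrightarrow> q < 21 * r \<Longrightarrow>
      (\<Sum>l<20 * r. P p l * slice_entry r X' Y' k l q) =
        t k * (\<Sum>l<21 * r. slice_entry r X Y k p l * S l q)"
    and t: "\<And>k. k < 3 \<Longrightarrow> t k \<noteq> 0"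
    and a: "a < r"
  shows "r \<le> q \<Longrightarrow> q < 21 * r \<Longrightarrow> S a q = 0"
    and "b < r \<Longrightarrow> (\<Sum>c<r. S a c * X' $$ (c, b)) = (\<Sum>c<r. X $$ (a, c) * S c b)"
    and "b < r \<Longrightarrow> (\<Sum>c<r. S a c * Y' $$ (c, b)) = (\<Sum>c<r. Y $$ (a, c) * S c b)"
proof -
  have e0: "(if q < 2 * r then P p q else if 3 * r \<le> q \<and> q < 12 * r then P p (q - r) else 0)
      = t 0 * S p q" if "p < 2 * r" "q < 21 * r" for p q
    using eq[of 0 p q] that by (simp add: slice_entry_row slice_entry_col_0)
  have e1: "(if r \<le> q \<and> q < 3 * r \<or> 12 * r \<le> q \<and> q < 18 * r then P p (q - r) else 0)
      = t 1 * S (r + p) q" if "p < 2 * r" "q < 21 * r" for p q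
    using eq[of 1 p q] that by (simp only: slice_entry_row slice_entry_col_1)
  have t0: "t 0 \<noteq> 0" "t 1 \<noteq> 0" "t 2 \<noteq> 0" using t by simp_all
  \<comment> \<open>In a zero column of slice 0 the left side vanishes and \<open>t 0\<close>
    cancels; \<open>z1\<close> uses slice 1 in the same way.\<close>
  have z0: "S p q = 0" if "p < 2 * r" "2 * r \<le> q" "q < 3 * r \<or> 12 * r \<le> q" "q < 21 * r" for p q
    using e0[of p q] that t0 by (auto split: if_splits)
  have z1: "S (r + p) q = 0" if "p < 2 * r" "q < r \<or> 3 * r \<le> q \<and> q < 12 * r" "q < 21 * r" for p q
    using e1[of p q] that t0 by (auto split: if_splits)
  have p0: "P p q = t 0 * S p q" if "p < 2 * r" "q < 2 * r" for p q
    using e0[of p q] that by simp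
  have p1: "P p q = t 1 * S (r + p) (r + q)" if "p < 2 * r" "q < 2 * r" for p q
    using e1[of p "r + q"] that by simp
  \<comment> \<open>t_0 S_01 = P_01 = t_1 S_12, and S_12 = 0 by \<open>z0\<close>.\<close>
  have z2: "S p (r + c) = 0" if "p < r" "c < r" for p c
    using p0[of p "r + c"] p1[of p "r + c"] z0[of "r + p" "2 * r + c"] that t0
    by (simp add: mult_2 add.assoc)
  have P10: "P (r + p) c = 0" if "p < r" "c < r" for p c
    using p0[of "r + p" c] z1[of p c] that by simp
  \<comment> \<open>The identity blocks of slice 2 in the entries x + z and y + z compare P_00 with
    S_00 and with S_11, both with the factor \<open>t 2\<close>.\<close>
  have S00: "P p c = t 2 * S p c" "P p c = t 2 * S (r + p) (r + c)" if "p < r" "c < r" for p c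
  proof -
    show "P p c = t 2 * S p c"
      using eq[of 2 p c] that z1[of p c] by (simp add: slice_entry_row slice_entry_col_2)
    have "P p (r + d) = 0" if "d < r" for d
      using p0[of p "r + d"] z2[of p d] that \<open>p < r\<close> by simp
    then show "P p c = t 2 * S (r + p) (r + c)"
      using eq[of 2 p "r + c"] that z2[of p c] by (simp add: slice_entry_row slice_entry_col_2)
  qed
  have S11: "S (r + p) (r + c) = S p c" if "p < r" "c < r" for p c
    using S00[OF that] t0 by simp
  \<comment> \<open>P_11 = t_0 S_11 = t_0 S_00 = P_00 = t_2 S_00. This trades \<open>t 0\<close> for
    \<open>t 2\<close>, which will cancel in the equations of slice 2.\<close>
  have P11: "P (r + p) (r + c) = t 2 * S p c" if "p < r" "c < r" for p c
    using p0[of "r + p" "r + c"] p0[of p c] S00(1)[OF that] S11[OF that] that by auto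
  have S22: "S (2 * r + p) (2 * r + c) = S p c" if "p < r" "c < r" for p c
  proof -
    have "t 1 * S (2 * r + p) (2 * r + c) = P p c"
      using p1[of "r + p" "r + c"] P11[OF that] S00[OF that] that by (simp add: mult_2 add.assoc)
    also have "\<dots> = t 1 * S p c"
      using p1[of p c] S11[OF that] that by simp
    finally show ?thesis using t0 by simp
  qed
  have z12: "S (r + p) (2 * r + c) = 0" if "p < r" "c < r" for p c
    using z0[of "r + p" "2 * r + c"] that by simp
  have z21: "S (2 * r + p) (r + c) = 0" if "p < r" "c < r" for p c
    using p1[of "r + p" c] P10[OF that] that t0 by (simp add: mult_2 add.assoc)
  show "S a q = 0" if "r \<le> q" "q < 21 * r"
  proof -
    consider "q < 2 * r" | "2 * r \<le> q" "q < 3 * r \<or> 12 * r \<le> q" | "3 * r \<le> q" "q < 12 * r"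
      using that by linarith
    then show ?thesis
    proof cases
      case 1
      then show ?thesis using z2[of a "q - r"] a that by simp
    next
      case 2
      then show ?thesis using z0[of a q] a that by simp
    next
      \<comment> \<open>In the columns of the x identity blocks slice 0 only relates
        \<open>S\<close> to further entries of \<open>P\<close>. Slice 2 is zero there, so the sum
        of \<open>S a q\<close> and \<open>S (r + a) q\<close> vanishes, and the second term is zero
        by \<open>z1\<close>.\<close>
      case 3
      then show ?thesis
        using eq[of 2 a q] z1[of a q] a that t0 by (simp add: slice_entry_row slice_entry_col_2)
    qed
  qed
  assume b: "b < r"
  \<comment> \<open>Block row 1 of slice 2 reads P_10 + P_11 X' = t_2 (X S_11 + Y S_21) in block
    column 1, with P_10 = S_21 = 0. In block column 2 it reads P_11 Y' = t_2 (X S_12 + Y S_22), with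
    S_12 = 0.\<close>
  have "t 2 * (\<Sum>c<r. S a c * X' $$ (c, b)) = t 2 * (\<Sum>c<r. X $$ (a, c) * S c b)"
    using eq[of 2 "r + a" "r + b"] a b P10[of a b]
    by (simp add: slice_entry_row slice_entry_col_2 P11 S11 z21 sum_distrib_left mult.assoc)
  then show "(\<Sum>c<r. S a c * X' $$ (c, b)) = (\<Sum>c<r. X $$ (a, c) * S c b)"
    using t0 by simp
  have "t 2 * (\<Sum>c<r. S a c * Y' $$ (c, b)) = t 2 * (\<Sum>c<r. Y $$ (a, c) * S c b)"
    using eq[of 2 "r + a" "2 * r + b"] a b
    by (simp add: slice_entry_row slice_entry_col_2 P11 S22 z12 sum_distrib_left mult.assoc)
  then show "(\<Sum>c<r. S a c * Y' $$ (c, b)) = (\<Sum>c<r. Y $$ (a, c) * S c b)"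
    using t0 by simp
qed

subsection \<open>Reduction to diagonal mixing of the slices\<close>

text \<open>Associativity, where \<open>h\<close> is column \<open>p\<close> of a right inverse of
  \<open>g\<close>. It serves to cancel the matrices \<open>R\<close> and \<open>S\<close> of an
  equivalence entrywise.\<close>

lemma sum_mult_delta_kernel:
  fixes F :: "nat \<Rightarrow> 'k::comm_ring_1"
  assumes "\<And>i. i < n \<Longrightarrow> (\<Sum>l<m. g i l * h l) = (if i = p then 1 else 0)" "p < n"
  shows "(\<Sum>l<m. (\<Sum>i<n. F i * g i l) * h l) = F p"
proof -
  have "(\<Sum>l<m. (\<Sum>i<n. F i * g i l) * h l) = (\<Sum>l<m. \<Sum>i<n. F i * (g i l * h l))"
    by (simp add: sum_distrib_right mult.assoc)
  also have "\<dots> = (\<Sum>i<n. F i * (\<Sum>l<m. g i l * h l))"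
    by (subst sum.swap) (simp add: sum_distrib_left)
  also have "\<dots> = (\<Sum>i<n. if i = p then F i else 0)"
    using assms(1) by (intro sum.cong) auto
  finally show ?thesis using assms(2) by simp
qed

lemma sum_mult_mat_one:
  assumes "A * B = 1\<^sub>m n" "A \<in> carrier_mat n n" "B \<in> carrier_mat n n" "i < n" "j < n"
  shows "(\<Sum>l<n. A $$ (i, l) * B $$ (l, j)) = (if i = j then 1 else 0)"
proof -
  have "(A * B) $$ (i, j) = (\<Sum>l<n. A $$ (i, l) * B $$ (l, j))"
    using assms(2-) by (simp add: scalar_prod_def lessThan_atLeast0)
  then show ?thesis using assms by simp
qed

lemma invertible_matE:
  assumes "invertible_mat A" "A \<in> carrier_mat n n"
  obtains B where "B \<in> carrier_mat n n" "A * B = 1\<^sub>m n" "B * A = 1\<^sub>m n"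
proof -
  obtain B where B: "A * B = 1\<^sub>m n" "B * A = 1\<^sub>m (dim_row B)"
    using assms by (auto simp: invertible_mat_def inverts_mat_def)
  have "dim_col B = n" using arg_cong[OF B(1), of dim_col] by simp
  moreover have "dim_row B = n" using arg_cong[OF B(2), of dim_col] assms by simp
  ultimately show ?thesis using B that[of B] by auto
qed

text \<open>Outside these rows slice \<open>k\<close> is zero, so their number bounds its
  rank.\<close>

definition slice_rows :: "nat \<Rightarrow> nat \<Rightarrow> nat set" where
  "slice_rows r k = {..<2 * r} \<union>
     (if k = 0 then {2 * r..<11 * r} else if k = 1 then {11 * r..<17 * r} else {17 * r..<20 * r})"

text \<open>The left side factors through the nonzero rows of slice \<open>k\<close>. On rows
  \<open>I\<close> and the columns shifted by \<open>r\<close>, the combination on the right is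
  diagonal, with the coefficient of the identity block to which each row belongs.\<close>

lemma slice_combination_rank:
  fixes P H :: "nat \<Rightarrow> nat \<Rightarrow> 'k::field"
  assumes eq: "\<And>p q. p < 20 * r \<Longrightarrow> q < 21 * r \<Longrightarrow>
      (\<Sum>l<20 * r. P p l * (\<Sum>j<21 * r. slice_entry r X' Y' k l j * H j q)) =
        (\<Sum>\<kappa><3. \<tau> \<kappa> * slice_entry r X Y \<kappa> p q)"
    and I: "I \<subseteq> {2 * r..<20 * r}"
    and \<tau>: "\<And>p. p \<in> I \<Longrightarrow> \<tau> (if p < 11 * r then 0 else if p < 17 * r then 1 else 2) \<noteq> 0"
  shows "card I \<le> card (slice_rows r k)"
proof (rule card_le_of_diagonal_factorization)
  show "finite (slice_rows r k)" "finite I"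
    using I by (auto simp: slice_rows_def intro: finite_subset)
  let ?h = "\<lambda>l q. \<Sum>j<21 * r. slice_entry r X' Y' k l j * H j (q + r)"
  fix p q assume pq: "p \<in> I" "q \<in> I"
  have "(\<Sum>l\<in>slice_rows r k. P p l * ?h l q) = (\<Sum>l<20 * r. P p l * ?h l q)"
  proof (rule sum.mono_neutral_left)
    show "slice_rows r k \<subseteq> {..<20 * r}" by (auto simp: slice_rows_def)
    have "slice_entry r X' Y' k l j = 0" if "l < 20 * r" "l \<notin> slice_rows r k" for l j
      using that by (auto simp: slice_rows_def slice_entry_def split: if_splits)
    then show "\<forall>l\<in>{..<20 * r} - slice_rows r k. P p l * ?h l q = 0" by simp
  qed simp
  also have "\<dots> = (\<Sum>\<kappa><3. \<tau> \<kappa> * slice_entry r X Y \<kappa> p (q + r))"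
    using pq I by (intro eq) auto
  also have "\<dots> = (if p = q then \<tau> (if p < 11 * r then 0 else if p < 17 * r then 1 else 2) else 0)"
    using pq I by (auto simp: slice_entry_def numeral_3_eq_3 numeral_2_eq_2)
  finally show "(\<Sum>l\<in>slice_rows r k. P p l * ?h l q) =
    (if p = q then \<tau> (if p < 11 * r then 0 else if p < 17 * r then 1 else 2) else 0)" .
qed (use \<tau> in auto)

lemma card_slice_rows:
  "card (slice_rows r 0) = 11 * r" "card (slice_rows r (Suc 0)) = 8 * r" "card (slice_rows r 2) = 5 * r"
proof -
  have "slice_rows r 0 = {..<11 * r}" by (auto simp: slice_rows_def)
  then show "card (slice_rows r 0) = 11 * r" by simp
  show "card (slice_rows r (Suc 0)) = 8 * r" "card (slice_rows r 2) = 5 * r"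
    unfolding slice_rows_def by (subst card_Un_disjoint; auto)+
qed

text \<open>The identity blocks have 9, 6 and 3 block rows. Their sizes differ by at least 3, and
  the core adds only 2 block rows to each slice. Hence an unwanted coefficient in column
  \<open>k\<close> of \<open>T\<close> makes the combination's rank exceed the 11, 8 or 5 block rows
  available.\<close>

lemma slice_combination_diagonal:
  fixes P H :: "nat \<Rightarrow> nat \<Rightarrow> 'k::field"
  assumes r: "r > 0"
    and eq: "\<And>k p q. k < 3 \<Longrightarrow> p < 20 * r \<Longrightarrow> q < 21 * r \<Longrightarrow>
      (\<Sum>l<20 * r. P p l * (\<Sum>j<21 * r. slice_entry r X' Y' k l j * H j q)) =
        (\<Sum>\<kappa><3. T $$ (\<kappa>, k) * slice_entry r X Y \<kappa> p q)"
    and T: "T \<in> carrier_mat 3 3" "invertible_mat T"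
    and k: "k < 3"
  shows "T $$ (k, k) \<noteq> 0" and "\<kappa> < 3 \<Longrightarrow> \<kappa> \<noteq> k \<Longrightarrow> T $$ (\<kappa>, k) = 0"
proof -
  obtain W where W: "W \<in> carrier_mat 3 3" "W * T = 1\<^sub>m 3"
    using T by (auto elim: invertible_matE)
  have WT: "W $$ (i, 0) * T $$ (0, j) + W $$ (i, 1) * T $$ (1, j) + W $$ (i, 2) * T $$ (2, j)
      = (if i = j then 1 else 0)" if "i < 3" "j < 3" for i j
    using sum_mult_mat_one[OF W(2,1) T(1) that] by (simp add: numeral_3_eq_3 numeral_2_eq_2)
  have rank: False
    if "k < 3" "I \<subseteq> {2 * r..<20 * r}" "card (slice_rows r k) < card I"
      "\<And>p. p \<in> I \<Longrightarrow> T $$ (if p < 11 * r then 0 else if p < 17 * r then 1 else 2, k) \<noteq> 0" for I k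
    using slice_combination_rank[where \<tau> = "\<lambda>\<kappa>. T $$ (\<kappa>, k)", OF eq that(2,4)] that(1,3)
    by simp
  \<comment> \<open>Counting block rows, 9 > 5, 6 > 5 and 9 > 8, so \<open>T\<close> is lower
    triangular.\<close>
  have T02: "T $$ (0, 2) = 0"
    by (rule ccontr, rule rank[of 2 "{2 * r..<11 * r}"]) (use r in \<open>auto simp: card_slice_rows\<close>)
  have T12: "T $$ (1, 2) = 0"
    by (rule ccontr, rule rank[of 2 "{11 * r..<17 * r}"]) (use r in \<open>auto simp: card_slice_rows\<close>)
  have T01: "T $$ (0, 1) = 0"
    by (rule ccontr, rule rank[of 1 "{2 * r..<11 * r}"]) (use r in \<open>auto simp: card_slice_rows\<close>)
  \<comment> \<open>Reading \<open>W * T = 1\<^sub>m 3\<close> from the last column backwards shows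
    that \<open>W\<close> is lower triangular too and that the diagonal entries of \<open>T\<close>
    are nonzero.\<close>
  have T22: "T $$ (2, 2) \<noteq> 0" and W02: "W $$ (0, 2) = 0" and W12: "W $$ (1, 2) = 0"
    using WT[of 2 2] WT[of 0 2] WT[of 1 2] T02 T12 by auto
  have T11: "T $$ (1, 1) \<noteq> 0" and W01: "W $$ (0, 1) = 0"
    using WT[of 1 1] WT[of 0 1] T01 W02 W12 by auto
  have T00: "T $$ (0, 0) \<noteq> 0"
    using WT[of 0 0] W01 W02 by auto
  \<comment> \<open>Now each diagonal block counts as well: 6 + 3 > 8, 9 + 6 > 11 and 9 + 3 >
    11.\<close>
  have T21: "T $$ (2, 1) = 0"
    by (rule ccontr, rule rank[of 1 "{11 * r..<20 * r}"]) (use r T11 in \<open>auto simp: card_slice_rows\<close>)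
  have T10: "T $$ (1, 0) = 0"
    by (rule ccontr, rule rank[of 0 "{2 * r..<17 * r}"]) (use r T00 in \<open>auto simp: card_slice_rows\<close>)
  have card12: "card ({2 * r..<11 * r} \<union> {17 * r..<20 * r}) = 12 * r"
    by (subst card_Un_disjoint) auto
  have T20: "T $$ (2, 0) = 0"
    by (rule ccontr, rule rank[of 0 "{2 * r..<11 * r} \<union> {17 * r..<20 * r}"])
      (use r T00 card12 in \<open>auto simp: card_slice_rows\<close>)
  have "k = 0 \<or> k = 1 \<or> k = 2" using k by auto
  then show "T $$ (k, k) \<noteq> 0" using T00 T11 T22 by auto
  assume "\<kappa> < 3" "\<kappa> \<noteq> k"
  moreover from this have "\<kappa> = 0 \<or> \<kappa> = 1 \<or> \<kappa> = 2" by auto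
  ultimately show "T $$ (\<kappa>, k) = 0"
    using \<open>k = 0 \<or> k = 1 \<or> k = 2\<close> T01 T02 T10 T12 T20 T21 by auto
qed

section \<open>Recovering similarity from equivalence\<close>

lemma pair_sim_of_spatial_equiv:
  fixes X Y X' Y' :: "'k::field mat"
  assumes X: "X \<in> carrier_mat r r" "Y \<in> carrier_mat r r"
    and X': "X' \<in> carrier_mat r r" "Y' \<in> carrier_mat r r"
    and equiv: "spatial_equiv (map (nc_subst X Y) [slice 0, slice 1, slice 2])
        (map (nc_subst X' Y') [slice 0, slice 1, slice 2])"
    and r: "r > 0"
  shows "pair_sim (X, Y) (X', Y')"
proof -
  let ?A = "\<lambda>k. nc_subst X Y (slice k)" and ?A' = "\<lambda>k. nc_subst X' Y' (slice k)"
  define As As' where "As = map (nc_subst X Y) [slice 0, slice 1, slice 2]"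
    and "As' = map (nc_subst X' Y') [slice 0, slice 1, slice 2]"
  have nth: "As ! k = ?A k" "As' ! k = ?A' k" if "k < 3" for k
  proof -
    have "k = 0 \<or> k = 1 \<or> k = 2" using that by auto
    then show "As ! k = ?A k" "As' ! k = ?A' k" by (auto simp: As_def As'_def)
  qed
  obtain m n R S T where
    c: "\<forall>k<3. As ! k \<in> carrier_mat m n \<and> As' ! k \<in> carrier_mat m n"
    and R: "R \<in> carrier_mat m m" "invertible_mat R"
    and S: "S \<in> carrier_mat n n" "invertible_mat S"
    and T: "T \<in> carrier_mat 3 3" "invertible_mat T"
    and eq: "\<forall>i'<m. \<forall>j'<n. \<forall>k'<3. As' ! k' $$ (i', j') =
        (\<Sum>i<m. \<Sum>j<n. \<Sum>k<3. As ! k $$ (i, j) * R $$ (i, i') * S $$ (j, j') * T $$ (k, k'))"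
    using equiv[folded As_def As'_def] unfolding spatial_equiv_def by blast
  have "?A 0 \<in> carrier_mat m n" using c by (simp flip: nth)
  then have mn: "m = 20 * r" "n = 21 * r"
    using nc_subst_carrier[OF X(1), of Y "slice 0"] by (auto simp: dim_slice)
  obtain Ri where Ri: "Ri \<in> carrier_mat m m" "R * Ri = 1\<^sub>m m"
    using R by (auto elim: invertible_matE)
  obtain Si where Si: "Si \<in> carrier_mat n n" "S * Si = 1\<^sub>m n"
    using S by (auto elim: invertible_matE)
  \<comment> \<open>The definition of equivalence sums over the first index of \<open>R\<close>, so
    \<open>R\<close> acts from the left as its transpose; \<open>P\<close> is the inverse of that
    transpose.\<close>
  define P where "P p l = Ri $$ (l, p)" for p l
  define comb where "comb k p q = (\<Sum>\<kappa><3. T $$ (\<kappa>, k) * slice_entry r X Y \<kappa> p q)" for k p q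
  have eq1: "(\<Sum>l<m. P p l * slice_entry r X' Y' k l q) = (\<Sum>j<n. comb k p j * S $$ (j, q))"
    if "k < 3" "p < m" "q < n" for k p q
  proof -
    have "slice_entry r X' Y' k l q = (\<Sum>i<m. (\<Sum>j<n. comb k i j * S $$ (j, q)) * R $$ (i, l))"
      if "l < m" for l
    proof -
      have "slice_entry r X' Y' k l q = ?A' k $$ (l, q)"
        using that \<open>q < n\<close> \<open>k < 3\<close> X' by (simp add: nc_subst_slice mn)
      also have "\<dots> = (\<Sum>i<m. \<Sum>j<n. \<Sum>\<kappa><3. ?A \<kappa> $$ (i, j) * R $$ (i, l) * S $$ (j, q) * T $$ (\<kappa>, k))"
        using eq that \<open>q < n\<close> \<open>k < 3\<close> by (simp add: nth cong: sum.cong_simp)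
      also have "\<dots> = (\<Sum>i<m. \<Sum>j<n. \<Sum>\<kappa><3.
          T $$ (\<kappa>, k) * slice_entry r X Y \<kappa> i j * S $$ (j, q) * R $$ (i, l))"
        using X by (intro sum.cong) (auto simp: nc_subst_slice mn mult_ac)
      also have "\<dots> = (\<Sum>i<m. (\<Sum>j<n. comb k i j * S $$ (j, q)) * R $$ (i, l))"
        by (simp add: comb_def sum_distrib_right)
      finally show ?thesis .
    qed
    then have "(\<Sum>l<m. P p l * slice_entry r X' Y' k l q) =
        (\<Sum>l<m. (\<Sum>i<m. (\<Sum>j<n. comb k i j * S $$ (j, q)) * R $$ (i, l)) * Ri $$ (l, p))"
      by (intro sum.cong) (simp_all add: P_def mult.commute)
    also have "\<dots> = (\<Sum>j<n. comb k p j * S $$ (j, q))"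
      using sum_mult_mat_one[OF Ri(2) R(1) Ri(1)] that by (intro sum_mult_delta_kernel) auto
    finally show ?thesis .
  qed
  \<comment> \<open>Cancelling \<open>S\<close> as well isolates the combination of the slices, to
    which the rank bound applies.\<close>
  have eq2: "(\<Sum>l<20 * r. P p l * (\<Sum>j<21 * r. slice_entry r X' Y' k l j * Si $$ (j, q))) =
      (\<Sum>\<kappa><3. T $$ (\<kappa>, k) * slice_entry r X Y \<kappa> p q)"
    if "k < 3" "p < 20 * r" "q < 21 * r" for k p q
  proof -
    have "(\<Sum>l<m. P p l * (\<Sum>j<n. slice_entry r X' Y' k l j * Si $$ (j, q))) =
        (\<Sum>l<m. \<Sum>j<n. P p l * slice_entry r X' Y' k l j * Si $$ (j, q))"
      by (simp add: sum_distrib_left mult.assoc)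
    also have "\<dots> = (\<Sum>j<n. (\<Sum>l<m. P p l * slice_entry r X' Y' k l j) * Si $$ (j, q))"
      by (subst sum.swap) (simp add: sum_distrib_right)
    also have "\<dots> = (\<Sum>j<n. (\<Sum>i<n. comb k p i * S $$ (i, j)) * Si $$ (j, q))"
      using eq1[of k p] that by (intro sum.cong) (simp_all add: mn)
    also have "\<dots> = comb k p q"
      using sum_mult_mat_one[OF Si(2) S(1) Si(1)] that by (intro sum_mult_delta_kernel) (auto simp: mn)
    finally show ?thesis by (simp add: comb_def mn)
  qed
  have diag: "T $$ (k, k) \<noteq> 0" "\<kappa> < 3 \<Longrightarrow> \<kappa> \<noteq> k \<Longrightarrow> T $$ (\<kappa>, k) = 0" if "k < 3" for k \<kappa>
    using slice_combination_diagonal[where P = P and H = "\<lambda>j q. Si $$ (j, q)", OF r _ T that] eq2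
    by blast+
  have comb: "comb k p q = T $$ (k, k) * slice_entry r X Y k p q" if "k < 3" for k p q
  proof -
    have "comb k p q = (\<Sum>\<kappa><3. if \<kappa> = k then T $$ (k, k) * slice_entry r X Y k p q else 0)"
      unfolding comb_def using diag(2) that by (intro sum.cong) auto
    then show ?thesis using that by simp
  qed
  have eq3: "(\<Sum>l<20 * r. P p l * slice_entry r X' Y' k l q) =
      T $$ (k, k) * (\<Sum>l<21 * r. slice_entry r X Y k p l * S $$ (l, q))"
    if "k < 3" "p < 20 * r" "q < 21 * r" for k p q
    using eq1[of k p q] that by (simp add: mn comb sum_distrib_left mult.assoc)
  note row = intertwining_first_row[where P = P and S = "\<lambda>p q. S $$ (p, q)" and t = "\<lambda>k. T $$ (k, k)"]
  have row_0: "S $$ (a, q) = 0" if "a < r" "r \<le> q" "q < 21 * r" for a q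
    by (rule row(1)[OF eq3 diag(1) that])
  have row_X: "(\<Sum>c<r. S $$ (a, c) * X' $$ (c, b)) = (\<Sum>c<r. X $$ (a, c) * S $$ (c, b))"
    if "a < r" "b < r" for a b
    by (rule row(2)[OF eq3 diag(1) that])
  have row_Y: "(\<Sum>c<r. S $$ (a, c) * Y' $$ (c, b)) = (\<Sum>c<r. Y $$ (a, c) * S $$ (c, b))"
    if "a < r" "b < r" for a b
    by (rule row(3)[OF eq3 diag(1) that])
  \<comment> \<open>By \<open>row_0\<close> the first block row of \<open>S\<close> is
    \<open>C\<close> followed by zeros, so \<open>C * D\<close> is the leading block of
    \<open>S * Si\<close>.\<close>
  define C where "C = mat r r (\<lambda>(i, j). S $$ (i, j))"
  define D where "D = mat r r (\<lambda>(i, j). Si $$ (i, j))"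
  have C: "C \<in> carrier_mat r r" and D: "D \<in> carrier_mat r r" by (simp_all add: C_def D_def)
  have CD: "C * D = 1\<^sub>m r"
  proof (rule eq_matI)
    fix a b assume "a < dim_row (1\<^sub>m r :: 'k mat)" "b < dim_col (1\<^sub>m r :: 'k mat)"
    then have ab: "a < r" "b < r" by auto
    have "(C * D) $$ (a, b) = (\<Sum>l<r. S $$ (a, l) * Si $$ (l, b))"
      using ab by (simp add: C_def D_def scalar_prod_def lessThan_atLeast0)
    also have "\<dots> = (\<Sum>l<n. S $$ (a, l) * Si $$ (l, b))"
      using row_0 ab by (intro sum.mono_neutral_left) (auto simp: mn)
    also have "\<dots> = (if a = b then 1 else 0)"
      using sum_mult_mat_one[OF Si(2) S(1) Si(1)] ab by (simp add: mn)
    finally show "(C * D) $$ (a, b) = 1\<^sub>m r $$ (a, b)" using ab by simp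
  qed (simp_all add: C_def D_def)
  have DC: "D * C = 1\<^sub>m r"
    using mat_mult_left_right_inverse[OF C D CD] .
  have "C * X' = X * C" "C * Y' = Y * C"
    using X X' row_X row_Y
    by (auto intro!: eq_matI simp: C_def scalar_prod_def lessThan_atLeast0)
  then have "D * (C * X') = D * X * C" "D * (C * Y') = D * Y * C"
    using X C D by (simp_all add: assoc_mult_mat[of _ r r _ r _ r])
  then have "X' = D * X * C" "Y' = D * Y * C"
    using X' C D DC by (simp_all flip: assoc_mult_mat[of _ r r _ r _ r])
  then show ?thesis
    unfolding pair_sim_def fst_conv snd_conv using X C D CD DC by blast
qed

subsection \<open>Blockwise conjugation\<close>

lemma sum_lessThan_blocks:
  fixes f :: "nat \<Rightarrow> 'a::comm_monoid_add"
  shows "(\<Sum>p<n * r. f p) = (\<Sum>i<n. \<Sum>a<r. f (i * r + a))"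
proof -
  have "(\<Sum>p\<in>{i * r..<i * r + r}. f p) = (\<Sum>a<r. f (i * r + a))" for i
    using sum.shift_bounds_nat_ivl[of f 0 "i * r" r] by (simp add: lessThan_atLeast0 add.commute)
  then show ?thesis by (simp flip: sum.nat_group)
qed

text \<open>The Kronecker product of the identity matrix of size \<open>n\<close> with
  \<open>M\<close>.\<close>

definition block_diag :: "nat \<Rightarrow> nat \<Rightarrow> 'k::field mat \<Rightarrow> 'k mat" where
  "block_diag n r M =
     mat (n * r) (n * r) (\<lambda>(p, q). if p div r = q div r then M $$ (p mod r, q mod r) else 0)"

lemma block_diag_carrier: "block_diag n r M \<in> carrier_mat (n * r) (n * r)"
  by (simp add: block_diag_def)

lemma block_diag_index:
  assumes "i < n" "j < n" "a < r" "b < r"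
  shows "block_diag n r M $$ (i * r + a, j * r + b) = (if i = j then M $$ (a, b) else 0)"
  using assms by (simp add: block_diag_def block_index_less_iff)

lemma sum_block_diag:
  fixes f :: "nat \<Rightarrow> 'k::field"
  assumes "j < n" "b < r"
  shows "(\<Sum>p<n * r. f p * block_diag n r M $$ (p, j * r + b)) = (\<Sum>a<r. f (j * r + a) * M $$ (a, b))"
proof -
  have "(\<Sum>p<n * r. f p * block_diag n r M $$ (p, j * r + b)) =
      (\<Sum>i<n. if i = j then \<Sum>a<r. f (i * r + a) * M $$ (a, b) else 0)"
    unfolding sum_lessThan_blocks using assms by (intro sum.cong) (auto simp: block_diag_index)
  then show ?thesis using assms by simp
qed

lemma block_diag_mult_inverse:
  assumes "A \<in> carrier_mat r r" "B \<in> carrier_mat r r" "A * B = 1\<^sub>m r"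
  shows "block_diag n r A * block_diag n r B = 1\<^sub>m (n * r)"
proof (rule eq_matI)
  fix p q assume "p < dim_row (1\<^sub>m (n * r) :: 'a mat)" "q < dim_col (1\<^sub>m (n * r) :: 'a mat)"
  then have pq: "p < n * r" "q < n * r" by auto
  obtain i a where i: "i < n" "a < r" "p = i * r + a" using pq(1) by (rule block_index_less)
  obtain j b where j: "j < n" "b < r" "q = j * r + b" using pq(2) by (rule block_index_less)
  have "(block_diag n r A * block_diag n r B) $$ (p, q) =
      (\<Sum>l<n * r. block_diag n r A $$ (p, l) * block_diag n r B $$ (l, q))"
    using pq block_diag_carrier[of n r A] block_diag_carrier[of n r B]
    by (simp add: scalar_prod_def lessThan_atLeast0)
  also have "\<dots> = (if i = j then \<Sum>c<r. A $$ (a, c) * B $$ (c, b) else 0)"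
    using i j by (simp add: sum_block_diag block_diag_index)
  also have "\<dots> = 1\<^sub>m (n * r) $$ (p, q)"
    using pq i j sum_mult_mat_one[OF assms(3,1,2)] by (simp add: block_index_eq_iff)
  finally show "(block_diag n r A * block_diag n r B) $$ (p, q) = 1\<^sub>m (n * r) $$ (p, q)" .
qed (simp_all add: block_diag_def)

lemma invertible_block_diag:
  assumes "A \<in> carrier_mat r r" "B \<in> carrier_mat r r" "A * B = 1\<^sub>m r" "B * A = 1\<^sub>m r"
  shows "invertible_mat (block_diag n r A)"
  unfolding invertible_mat_def inverts_mat_def
  using block_diag_mult_inverse[OF assms(1-3), of n] block_diag_mult_inverse[OF assms(2,1,4), of n]
  by (intro conjI exI[of _ "block_diag n r B"]) (simp_all add: block_diag_def)

text \<open>Conjugation is an algebra homomorphism that fixes scalars, so it commutes with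
  evaluating noncommutative polynomials.\<close>

lemma nc_eval_conj:
  assumes X: "X \<in> carrier_mat r r" "Y \<in> carrier_mat r r"
    and S: "S \<in> carrier_mat r r" "Si \<in> carrier_mat r r" "S * Si = 1\<^sub>m r" "Si * S = 1\<^sub>m r"
  shows "nc_eval (Si * X * S) (Si * Y * S) p = Si * nc_eval X Y p * S"
proof (induction p)
  case (NConst c)
  then show ?case using X S by (simp add: mult_smult_distrib[of _ r r _ r] mult_smult_assoc_mat[of _ r r _ r])
next
  case (NAdd p q)
  then show ?case
    using S nc_eval_carrier[OF X, of p] nc_eval_carrier[OF X, of q]
    by (simp add: mult_add_distrib_mat[of _ r r _ r] add_mult_distrib_mat[of _ r r _ _ r])
next
  case (NMul p q)
  let ?p = "nc_eval X Y p" and ?q = "nc_eval X Y q"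
  have c: "?p \<in> carrier_mat r r" "?q \<in> carrier_mat r r" using X by (auto intro: nc_eval_carrier)
  have "Si * ?p * S * (Si * ?q * S) = Si * ?p * (S * Si) * ?q * S"
    using S(1,2) c by (simp add: assoc_mult_mat[of _ r r _ r _ r])
  also have "\<dots> = Si * (?p * ?q) * S"
    using S c by (simp add: assoc_mult_mat[of _ r r _ r _ r])
  finally show ?case using NMul by simp
qed simp_all

text \<open>This works for any three polynomial matrices of a common shape: each block of each slice
  is conjugated by \<open>S\<close>, which block diagonal matrices on both sides achieve without
  mixing the slices.\<close>

lemma spatial_equiv_of_pair_sim:
  fixes X Y X' Y' :: "'k::field mat"
  assumes "pair_sim (X, Y) (X', Y')"
    and P: "length P = 3" "\<And>k. k < 3 \<Longrightarrow> P ! k \<in> carrier_mat m n"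
  shows "spatial_equiv (map (nc_subst X Y) P) (map (nc_subst X' Y') P)"
proof -
  obtain r S Si where X: "X \<in> carrier_mat r r" "Y \<in> carrier_mat r r"
    and S: "S \<in> carrier_mat r r" "Si \<in> carrier_mat r r" "S * Si = 1\<^sub>m r" "Si * S = 1\<^sub>m r"
    and X'_def: "X' = Si * X * S" and Y'_def: "Y' = Si * Y * S"
    using assms(1) by (auto simp: pair_sim_def)
  have X': "X' \<in> carrier_mat r r" using X S by (simp add: X'_def)
  let ?A = "\<lambda>k. nc_subst X Y (P ! k)" and ?A' = "\<lambda>k. nc_subst X' Y' (P ! k)"
  \<comment> \<open>The transpose compensates for \<open>R\<close> acting from the left as its
    transpose.\<close>
  let ?R = "block_diag m r Si\<^sup>T" and ?S = "block_diag n r S"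
  have tr: "Si\<^sup>T * S\<^sup>T = 1\<^sub>m r" "S\<^sup>T * Si\<^sup>T = 1\<^sub>m r"
    using transpose_mult[OF S(1,2)] transpose_mult[OF S(2,1)] S(3,4) by (metis transpose_one)+
  have entry: "?A' k $$ (p, q) = (\<Sum>i<m * r. \<Sum>j<n * r. \<Sum>\<kappa><3.
      ?A \<kappa> $$ (i, j) * ?R $$ (i, p) * ?S $$ (j, q) * 1\<^sub>m 3 $$ (\<kappa>, k))"
    if k: "k < 3" and p: "p < m * r" and q: "q < n * r" for p q k
  proof -
    obtain i a where i: "i < m" "a < r" "p = i * r + a" using p by (rule block_index_less)
    obtain j b where j: "j < n" "b < r" "q = j * r + b" using q by (rule block_index_less)
    have Pk: "i < dim_row (P ! k)" "j < dim_col (P ! k)" using P(2)[OF k] i j by auto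
    let ?E = "nc_eval X Y (P ! k $$ (i, j))"
    have E: "?E \<in> carrier_mat r r" using X by (rule nc_eval_carrier)
    have "(\<Sum>\<kappa><3. ?A \<kappa> $$ (i, j) * ?R $$ (i, p) * ?S $$ (j, q) * 1\<^sub>m 3 $$ (\<kappa>, k)) =
        ?A k $$ (i, j) * ?S $$ (j, q) * ?R $$ (i, p)" for i j
    proof -
      have "(\<Sum>\<kappa><3. ?A \<kappa> $$ (i, j) * ?R $$ (i, p) * ?S $$ (j, q) * 1\<^sub>m 3 $$ (\<kappa>, k)) =
          (\<Sum>\<kappa><3. if \<kappa> = k then ?A k $$ (i, j) * ?R $$ (i, p) * ?S $$ (j, q) else 0)"
        using k by (intro sum.cong) auto
      then show ?thesis using k by (simp add: mult_ac)
    qed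
    then have "(\<Sum>i<m * r. \<Sum>j<n * r. \<Sum>\<kappa><3.
        ?A \<kappa> $$ (i, j) * ?R $$ (i, p) * ?S $$ (j, q) * 1\<^sub>m 3 $$ (\<kappa>, k)) =
        (\<Sum>i<m * r. (\<Sum>j<n * r. ?A k $$ (i, j) * ?S $$ (j, q)) * ?R $$ (i, p))"
      by (simp add: sum_distrib_right)
    also have "\<dots> = (\<Sum>c<r. (\<Sum>d<r. ?A k $$ (i * r + c, j * r + d) * S $$ (d, b)) * Si\<^sup>T $$ (c, a))"
      using i j by (simp add: sum_block_diag)
    also have "\<dots> = (\<Sum>c<r. Si $$ (a, c) * (\<Sum>d<r. ?E $$ (c, d) * S $$ (d, b)))"
      using i j S nc_subst_index[OF X(1) Pk] by (intro sum.cong) (auto simp: mult.commute)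
    also have "\<dots> = (Si * (?E * S)) $$ (a, b)"
      using i j S E by (simp add: scalar_prod_def lessThan_atLeast0)
    also have "Si * (?E * S) = nc_eval X' Y' (P ! k $$ (i, j))"
      unfolding X'_def Y'_def nc_eval_conj[OF X S] using S E by (simp add: assoc_mult_mat[of _ r r _ r _ r])
    also have "\<dots> $$ (a, b) = ?A' k $$ (p, q)"
      unfolding i j using i j Pk X' by (simp add: nc_subst_index)
    finally show ?thesis by simp
  qed
  show ?thesis
    unfolding spatial_equiv_def
  proof (rule exI[of _ "m * r"], rule exI[of _ "n * r"], rule exI[of _ ?R], rule exI[of _ ?S],
      rule exI[of _ "1\<^sub>m 3"], intro conjI allI impI)
    show "invertible_mat ?R" "invertible_mat ?S"
      using S tr by (auto intro: invertible_block_diag[of _ r "S\<^sup>T"] invertible_block_diag[of _ r Si])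
    show "invertible_mat (1\<^sub>m 3 :: 'k mat)"
      by (auto simp: invertible_mat_def inverts_mat_def intro!: exI[of _ "1\<^sub>m 3"])
    fix p q k :: nat assume "p < m * r" "q < n * r" "k < 3"
    then show "map (nc_subst X' Y') P ! k $$ (p, q) = (\<Sum>i<m * r. \<Sum>j<n * r. \<Sum>\<kappa><3.
        map (nc_subst X Y) P ! \<kappa> $$ (i, j) * ?R $$ (i, p) * ?S $$ (j, q) * 1\<^sub>m 3 $$ (\<kappa>, k))"
      using entry[of k p q] P(1) by simp
  next
    fix k :: nat assume "k < 3"
    then show "map (nc_subst X Y) P ! k \<in> carrier_mat (m * r) (n * r)"
      "map (nc_subst X' Y') P ! k \<in> carrier_mat (m * r) (n * r)"
      using P nc_subst_carrier[OF X(1), of Y "P ! k"] nc_subst_carrier[OF X', of Y' "P ! k"] by auto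
  qed (use P(1) in \<open>simp_all add: block_diag_carrier\<close>)
qed

section \<open>Wildness of the classification problem\<close>

theorem theorem4p2:
  shows "spatial3_contains_pairs TYPE('k::field)"
  unfolding spatial3_contains_pairs_def
proof (intro exI[of _ "[slice 0, slice 1, slice 2]"] conjI allI impI)
  let ?T = "[slice 0, slice 1, slice 2] :: 'k ncpoly mat list"
  have T: "?T ! k \<in> carrier_mat 20 21" if "k < 3" for k
  proof -
    have "k = 0 \<or> k = 1 \<or> k = 2" using that by auto
    then show ?thesis by (auto simp: slice_def)
  qed
  fix XY :: "'k mat \<times> 'k mat" assume "is_pair XY"
  then obtain r where X: "fst XY \<in> carrier_mat r r" "snd XY \<in> carrier_mat r r"
    by (auto simp: is_pair_def)
  have "map (nc_subst (fst XY) (snd XY)) ?T ! k \<in> carrier_mat (20 * r) (21 * r)" if "k < 3" for k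
    using T[OF that] nc_subst_carrier[OF X(1), of "snd XY" "?T ! k"] that by (subst nth_map) auto
  then show "spatial3 (map (nc_subst (fst XY) (snd XY)) ?T)"
    unfolding spatial3_def by auto
  fix XY' :: "'k mat \<times> 'k mat" assume "is_pair XY'"
  then obtain r' where X': "fst XY' \<in> carrier_mat r' r'" "snd XY' \<in> carrier_mat r' r'"
    by (auto simp: is_pair_def)
  show "pair_sim XY XY' \<longleftrightarrow> spatial_equiv (map (nc_subst (fst XY) (snd XY)) ?T)
      (map (nc_subst (fst XY') (snd XY')) ?T)" (is "_ \<longleftrightarrow> ?equiv")
  proof
    show ?equiv if "pair_sim XY XY'"
      using that T by (intro spatial_equiv_of_pair_sim) (auto simp del: nth_Cons_numeral)
    assume equiv: ?equiv
    then obtain m n where "\<forall>k<3. map (nc_subst (fst XY) (snd XY)) ?T ! k \<in> carrier_mat m n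
        \<and> map (nc_subst (fst XY') (snd XY')) ?T ! k \<in> carrier_mat m n"
      unfolding spatial_equiv_def by blast
    \<comment> \<open>Equivalent spatial matrices have the same number of rows, here 20 r and 20
      r'.\<close>
    from this[rule_format, of 0] have "r' = r"
      using nc_subst_carrier[OF X(1), of "snd XY" "slice 0"]
        nc_subst_carrier[OF X'(1), of "snd XY'" "slice 0"] by (auto simp: dim_slice dest!: carrier_matD(1))
    note X' = X'[unfolded this]
    show "pair_sim XY XY'"
    \<comment> \<open>Empty slices put no constraint on \<open>T\<close>, so size 0 is treated
      apart; there all pairs coincide.\<close>
    proof (cases "r = 0")
      case True
      then show ?thesis
        unfolding pair_sim_def using X X'
        by (intro exI[of _ 0] exI[of _ "1\<^sub>m 0"]) (auto intro!: eq_matI)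
    next
      case False
      then show ?thesis
        using pair_sim_of_spatial_equiv[OF X X' equiv] by simp
    qed
  qed
qed simp

end
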